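(* Let $|\psi_0\rangle$ be a normalized two-photon state of modes $1,2$, let $M\in\mathrm{U}(3)$ with associated three-mode linear optical passive transformation $U$, and write $|\psi\rangle=U|\psi_0\rangle|1\rangle=\sum_{k=0}^{3}|\phi_k\rangle|k\rangle$, where the second factor refers to the ancillary mode $3$. Assume $|\phi_1\rangle\neq0$, and let $\mathcal{P}_1=\langle\phi_1|\phi_1\rangle$. Let $\eta\in(0,1]$ be the quantum efficiency of an on/off photodetector placed on mode $3$. Let $P_1$ be the probability of the "click" event, $P_1=\langle\psi|\,\mathbb{I}\otimes\mathbb{I}\otimes\Pi_1(\eta)\,|\psi\rangle$, and let $\varrho_1=\frac1{P_1}\mathrm{Tr}_3\left[|\psi\rangle\langle\psi|\;\mathbb{I}\otimes\mathbb{I}\otimes\Pi_1(\eta)\right]$ be the corresponding conditional state of modes $1,2$. Set $A_k(\eta)=1-(1-\eta)^k$. Then the fidelity $F=\langle\phi_1|\varrho_1|\phi_1\rangle/\langle\phi_1|\phi_1\rangle$ to the target state satisfies $$F=\frac{A_1(\eta)\langle\phi_1|\phi_1\rangle}{\sum_{k=1}^3A_k(\eta)\langle\phi_k|\phi_k\rangle}=\eta\,\frac{\mathcal{P}_1}{P_1}.$$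
   Context: Consider three bosonic modes with annihilation and creation operators $a_i,a_i^\dagger$, $[a_i,a_j^\dagger]=\delta_{ij}\mathbb{I}$, $[a_i,a_j]=0$, acting on the three-mode Fock space with vacuum $|000\rangle$. The number states are $|n_1n_2n_3\rangle=\prod_i (a_i^\dagger)^{n_i}/\sqrt{n_i!}\,|000\rangle$, also written $|n_1n_2\rangle|n_3\rangle$. A two-photon state of modes $1,2$ is a vector in the span of $|20\rangle,|11\rangle,|02\rangle$. The linear optical passive (LOP) transformation associated with $M\in\mathrm{U}(3)$ is the unitary operator $U$ on Fock space with $U^\dagger a_iU=\sum_j M_{ij}a_j$ and $U|000\rangle=|000\rangle$; it preserves the total photon number. An on/off detector of quantum efficiency $\eta$ on a single mode is described by the two-outcome POVM $\Pi_0(\eta)=\sum_{k=0}^\infty(1-\eta)^k|k\rangle\langle k|$ ("no click") and $\Pi_1(\eta)=\mathbb{I}-\Pi_0(\eta)$ ("click"), with the convention $0^0=1$. $\mathrm{Tr}_3$ is the partial trace over mode $3$. *)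

theory Defs
  imports "HOL-Analysis.Analysis"
begin

section \<open>Vectors in the number representation\<close>

text \<open>
  Fock space is \<open>\<ell>\<^sup>2\<close> over the occupation numbers: \<open>\<psi> x\<close> is the amplitude of \<open>\<psi>\<close> on the number
  state \<open>x\<close>. The index types are \<^typ>\<open>nat\<close> for a single mode, \<^typ>\<open>nat \<times> nat\<close> for modes 1, 2, and
  \<^typ>\<open>(nat \<times> nat) \<times> nat\<close> for all three modes.
\<close>

type_synonym 'a cvec = "'a \<Rightarrow> complex"
type_synonym 'a oper = "'a cvec \<Rightarrow> 'a cvec"
type_synonym occ3 = "(nat \<times> nat) \<times> nat"

definition ell2 :: "'a cvec set" where
  "ell2 = {\<psi>. (\<lambda>x. (cmod (\<psi> x))\<^sup>2) summable_on UNIV}"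

definition braket :: "'a cvec \<Rightarrow> 'a cvec \<Rightarrow> complex" where
  "braket \<phi> \<psi> = (\<Sum>\<^sub>\<infinity>x. cnj (\<phi> x) * \<psi> x)"

definition ket :: "'a \<Rightarrow> 'a cvec" where
  "ket x = (\<lambda>y. if y = x then 1 else 0)"

definition outer :: "'a cvec \<Rightarrow> 'a cvec \<Rightarrow> 'a oper" where
  "outer \<phi> \<psi> = (\<lambda>\<xi> x. braket \<psi> \<xi> * \<phi> x)"

definition tensor :: "'a cvec \<Rightarrow> 'b cvec \<Rightarrow> ('a \<times> 'b) cvec" where
  "tensor \<phi> f = (\<lambda>(x, k). \<phi> x * f k)"

text \<open>\<open>on_fst A\<close> is \<open>A \<otimes> \<I>\<close> and \<open>on_snd A\<close> is \<open>\<I> \<otimes> A\<close>.\<close>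

definition on_fst :: "'a oper \<Rightarrow> ('a \<times> 'b) oper" where
  "on_fst A \<psi> = (\<lambda>(x, k). A (\<lambda>y. \<psi> (y, k)) x)"

definition on_snd :: "'b oper \<Rightarrow> ('a \<times> 'b) oper" where
  "on_snd A \<psi> = (\<lambda>(x, k). A (\<lambda>l. \<psi> (x, l)) k)"

text \<open>\<open>bra_snd f\<close> is the partial inner product \<open>\<I> \<otimes> \<langle>f|\<close>.\<close>

definition bra_snd :: "'b cvec \<Rightarrow> ('a \<times> 'b) cvec \<Rightarrow> 'a cvec" where
  "bra_snd f \<psi> = (\<lambda>x. braket f (\<lambda>k. \<psi> (x, k)))"

definition partial_trace_snd :: "('a \<times> 'b) oper \<Rightarrow> 'a oper" where
  "partial_trace_snd T = (\<lambda>\<xi> x. \<Sum>\<^sub>\<infinity>k. bra_snd (ket k) (T (tensor \<xi> (ket k))) x)"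

text \<open>The adjoint of \<open>T\<close>, by \<open>\<langle>x|T\<^sup>\<dagger> \<phi>\<rangle> = \<langle>T x|\<phi>\<rangle>\<close> on the basis vectors \<open>|x\<rangle>\<close>.\<close>

definition adj_op :: "'a oper \<Rightarrow> 'a oper" where
  "adj_op T = (\<lambda>\<phi> x. braket (T (ket x)) \<phi>)"

definition unitary_op :: "'a oper \<Rightarrow> bool" where
  "unitary_op U \<longleftrightarrow>
     (\<forall>\<phi>\<in>ell2. \<forall>\<psi>\<in>ell2. \<forall>a b.
        U (\<lambda>x. a * \<phi> x + b * \<psi> x) = (\<lambda>x. a * U \<phi> x + b * U \<psi> x)) \<and>
     U ` ell2 = ell2 \<and>
     (\<forall>\<phi>\<in>ell2. \<forall>\<psi>\<in>ell2. braket (U \<phi>) (U \<psi>) = braket \<phi> \<psi>)"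


section \<open>Mode operators\<close>

definition annihilate :: "nat oper" where
  "annihilate f = (\<lambda>n. of_real (sqrt (real (n + 1))) * f (n + 1))"

definition create :: "nat oper" where
  "create f = (\<lambda>n. of_real (sqrt (real n)) * f (n - 1))"

text \<open>Modes are indexed by the three-element type \<^typ>\<open>3\<close>, in which \<open>3 = 0\<close>.\<close>

definition mode_op :: "3 \<Rightarrow> nat oper \<Rightarrow> occ3 oper" where
  "mode_op i A =
     (if i = 1 then on_fst (on_fst A)
      else if i = 2 then on_fst (on_snd A)
      else on_snd A)"

abbreviation ann :: "3 \<Rightarrow> occ3 oper" where
  "ann i \<equiv> mode_op i annihilate"

abbreviation cre :: "3 \<Rightarrow> occ3 oper" where
  "cre i \<equiv> mode_op i create"

abbreviation vacuum :: "occ3 cvec" where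
  "vacuum \<equiv> ket ((0, 0), 0)"

lemma tensor_ket: "tensor (ket x) (ket k) = ket (x, k)"
  by (auto simp: tensor_def ket_def fun_eq_iff)

lemma adj_annihilate: "adj_op annihilate = create"
proof (intro ext)
  fix \<phi> :: "nat cvec" and n
  have "braket (annihilate (ket n)) \<phi>
      = (\<Sum>\<^sub>\<infinity>m\<in>{n - 1}. cnj (annihilate (ket n) m) * \<phi> m)"
    unfolding braket_def
    by (rule infsum_cong_neutral) (auto simp: annihilate_def ket_def)
  also have "\<dots> = create \<phi> n"
    by (cases n) (auto simp: annihilate_def create_def ket_def)
  finally show "adj_op annihilate \<phi> n = create \<phi> n"
    by (simp add: adj_op_def)
qed

lemma single_mode_ccr: "annihilate (create f) n - create (annihilate f) n = f n"
proof -
  have "of_real (sqrt (real n + 1)) * (of_real (sqrt (real n + 1)) * z) = (of_nat n + 1) * z"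
    "of_real (sqrt (1 + real n)) * (of_real (sqrt (1 + real n)) * z) = (of_nat n + 1) * z"
    for n and z :: complex
    by (simp_all flip: of_real_mult mult.assoc)
  then show ?thesis
    by (cases n) (simp_all add: annihilate_def create_def ring_distribs)
qed

lemma ccr: "ann i (cre j \<psi>) x - cre j (ann i \<psi>) x = (if i = j then \<psi> x else 0)"
proof -
  obtain n1 n2 n3 where x: "x = ((n1, n2), n3)"
    by (metis surj_pair)
  show ?thesis
  proof (cases "i = j")
    case True
    then show ?thesis
      using exhaust_3[of j]
      by (auto simp: x mode_op_def on_fst_def on_snd_def single_mode_ccr)
  next
    case False
    then show ?thesis
      using exhaust_3[of i] exhaust_3[of j]
      by (auto simp: x mode_op_def on_fst_def on_snd_def annihilate_def create_def)
  qed
qed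

lemma ann_commute: "ann i (ann j \<psi>) = ann j (ann i \<psi>)"
  using exhaust_3[of i] exhaust_3[of j]
  by (auto simp: fun_eq_iff mode_op_def on_fst_def on_snd_def annihilate_def)

lemma create_funpow:
  "(create ^^ n) (\<lambda>m. c * ket 0 m) = (\<lambda>m. c * (of_real (sqrt (fact n)) * ket n m))"
proof (induction n)
  case (Suc n)
  have "create (\<lambda>m. c * (of_real (sqrt (fact n)) * ket n m)) m =
      c * (of_real (sqrt (fact (Suc n))) * ket (Suc n) m)" for m
    by (cases m) (simp_all add: create_def ket_def real_sqrt_mult)
  then show ?case
    by (simp add: Suc fun_eq_iff)
qed (simp add: ket_def)

lemma on_fst_funpow: "on_fst A ^^ n = on_fst (A ^^ n)"
  by (induction n) (simp_all add: on_fst_def fun_eq_iff)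

lemma on_snd_funpow: "on_snd A ^^ n = on_snd (A ^^ n)"
  by (induction n) (simp_all add: on_snd_def fun_eq_iff)

lemma mode_op_funpow: "mode_op i A ^^ n = mode_op i (A ^^ n)"
  by (simp add: mode_op_def on_fst_funpow on_snd_funpow)

lemma number_state:
  "(cre 1 ^^ n1) ((cre 2 ^^ n2) ((cre 3 ^^ n3) vacuum)) =
     (\<lambda>x. of_real (sqrt (fact n1) * sqrt (fact n2) * sqrt (fact n3)) * ket ((n1, n2), n3) x)"
proof -
  have vac: "vacuum = (\<lambda>((a, b), c). (ket 0 a * ket 0 b) * ket 0 c)"
    by (auto simp: ket_def fun_eq_iff)
  have 3: "(cre 3 ^^ n3) vacuum =
      (\<lambda>((a, b), c). (of_real (sqrt (fact n3)) * ket 0 a * ket n3 c) * ket 0 b)"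
    by (simp only: vac mode_op_funpow, simp add: mode_op_def on_snd_def create_funpow fun_eq_iff)
  have 2: "(cre 2 ^^ n2) \<dots> =
      (\<lambda>((a, b), c). (of_real (sqrt (fact n3) * sqrt (fact n2)) * ket n3 c * ket n2 b) * ket 0 a)"
    by (simp only: mode_op_funpow, simp add: mode_op_def on_fst_def on_snd_def create_funpow fun_eq_iff)
  have 1: "(cre 1 ^^ n1) \<dots> =
      (\<lambda>((a, b), c). (of_real (sqrt (fact n3) * sqrt (fact n2)) * ket n3 c * ket n2 b) *
        (of_real (sqrt (fact n1)) * ket n1 a))"
    by (simp only: mode_op_funpow, simp add: mode_op_def on_fst_def create_funpow fun_eq_iff)
  show ?thesis
    unfolding 3 2 1 by (auto simp: ket_def fun_eq_iff)
qed


section \<open>Passive linear optics and on/off detection\<close>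

definition two_photon :: "(nat \<times> nat) cvec \<Rightarrow> bool" where
  "two_photon \<psi> \<longleftrightarrow>
     (\<exists>\<alpha> \<beta> \<gamma>. \<psi> = (\<lambda>x. \<alpha> * ket (2, 0) x + \<beta> * ket (1, 1) x + \<gamma> * ket (0, 2) x))"

definition cadjoint :: "complex^'n^'m \<Rightarrow> complex^'m^'n" where
  "cadjoint M = (\<chi> i j. cnj (M $ j $ i))"

definition unitary_matrix :: "complex^'n^'n \<Rightarrow> bool" where
  "unitary_matrix M \<longleftrightarrow> cadjoint M ** M = mat 1 \<and> M ** cadjoint M = mat 1"

text \<open>
  The mode operators are unbounded, so \<open>U\<^sup>\<dagger> a\<^sub>i U = \<Sum>\<^sub>j M\<^sub>i\<^sub>j a\<^sub>j\<close> is required on the vectors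
  that are finite combinations of number states; there \<open>U \<psi>\<close> has to lie in the domain of \<open>a\<^sub>i\<close>.
\<close>

definition LOP :: "complex^3^3 \<Rightarrow> occ3 oper \<Rightarrow> bool" where
  "LOP M U \<longleftrightarrow>
     unitary_op U \<and>
     (\<forall>i \<psi>. finite {x. \<psi> x \<noteq> 0} \<longrightarrow>
        ann i (U \<psi>) \<in> ell2 \<and>
        adj_op U (ann i (U \<psi>)) = (\<lambda>x. \<Sum>j\<in>UNIV. M $ i $ j * ann j \<psi> x)) \<and>
     U vacuum = vacuum"

definition Pi0 :: "real \<Rightarrow> nat oper" where
  "Pi0 \<eta> = (\<lambda>f n. \<Sum>\<^sub>\<infinity>k. of_real ((1 - \<eta>) ^ k) * outer (ket k) (ket k) f n)"

definition Pi1 :: "real \<Rightarrow> nat oper" where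
  "Pi1 \<eta> = (\<lambda>f n. f n - Pi0 \<eta> f n)"

end

theory Submission
  imports Defs
begin

text \<open>
  Each relation \<open>a\<^sub>i U = U (\<Sum>\<^sub>j M\<^sub>i\<^sub>j a\<^sub>j)\<close> lowers the photon number by one, so by induction on it \<open>U\<close>
  preserves the photon number; only the vacuum amplitude is invisible to the \<open>a\<^sub>i\<close>, and it is fixed
  because \<open>U\<close> preserves inner products and the vacuum. Hence \<open>\<phi>\<^sub>k\<close> has \<open>3 - k\<close> photons: the
  \<open>\<phi>\<^sub>k\<close> are orthogonal, and only the \<open>k = 1\<close> term of the conditional state contributes to the fidelity.
\<close>

section \<open>Photon-number sectors and annihilation operators\<close>

fun photons :: "occ3 \<Rightarrow> nat" where
  "photons ((n1, n2), n3) = n1 + n2 + n3"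

definition fixed_photons :: "nat \<Rightarrow> occ3 cvec \<Rightarrow> bool" where
  "fixed_photons N \<psi> \<longleftrightarrow> (\<forall>x. photons x \<noteq> N \<longrightarrow> \<psi> x = 0)"

lemma finite_photons: "finite {x. photons x = N}"
proof (rule finite_subset)
  show "{x. photons x = N} \<subseteq> ({..N} \<times> {..N}) \<times> {..N}"
    by auto
qed simp

text \<open>Each photon-number sector is spanned by finitely many number states, so its vectors meet
  the finite-support condition of \<open>LOP\<close> and lie in \<open>ell2\<close>.\<close>

lemma fixed_photons_finite: "fixed_photons N \<psi> \<Longrightarrow> finite {x. \<psi> x \<noteq> 0}"
  by (rule finite_subset[OF _ finite_photons[of N]]) (auto simp: fixed_photons_def simp del: split_paired_All)

text \<open>Only one of the two vectors has to vanish at each point off \<open>S\<close>. The other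
  may be arbitrary, even outside \<open>ell2\<close>, and no summability question arises.\<close>

lemma braket_eq_sum:
  assumes "finite S" and "\<And>x. x \<notin> S \<Longrightarrow> \<phi> x = 0 \<or> \<psi> x = 0"
  shows "braket \<phi> \<psi> = (\<Sum>x\<in>S. cnj (\<phi> x) * \<psi> x)"
proof -
  have "braket \<phi> \<psi> = (\<Sum>\<^sub>\<infinity>x\<in>S. cnj (\<phi> x) * \<psi> x)"
    unfolding braket_def by (rule infsum_cong_neutral) (use assms(2) in force)+
  then show ?thesis
    using assms(1) by simp
qed

lemma braket_ket: "braket (ket x) \<psi> = \<psi> x"
  by (subst braket_eq_sum[where S = "{x}"]) (auto simp: ket_def)

lemma finite_support_ell2: "finite {x. \<psi> x \<noteq> 0} \<Longrightarrow> \<psi> \<in> ell2"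
  unfolding ell2_def mem_Collect_eq
  by (subst summable_on_cong_neutral[where T = "{x. \<psi> x \<noteq> 0}" and g = "\<lambda>x. (cmod (\<psi> x))\<^sup>2"]) auto

lemma ket_ell2: "ket x \<in> ell2"
  by (rule finite_support_ell2) (simp add: ket_def)

lemma fixed_photons_ann:
  assumes "fixed_photons (Suc N) \<psi>"
  shows "fixed_photons N (ann i \<psi>)"
  unfolding fixed_photons_def
proof (intro allI impI)
  fix x assume "photons x \<noteq> N"
  then show "ann i \<psi> x = 0"
    using assms exhaust_3[of i]
    by (cases x rule: photons.cases)
      (auto simp: fixed_photons_def mode_op_def on_fst_def on_snd_def annihilate_def)
qed

text \<open>Some mode of \<open>x\<close> is occupied: \<open>y\<close> is \<open>x\<close> with one
  photon of that mode removed, and \<open>c\<close> is the square root of its occupation number.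
  Neither depends on \<psi>, so the amplitude at \<open>x\<close> can be read off from
  \<open>ann i \<psi>\<close> for every \<psi>.\<close>

lemma ann_detects:
  assumes "photons x = Suc n"
  obtains i y c where "photons y = n" and "c \<noteq> 0" and "\<And>\<psi>. ann i \<psi> y = c * \<psi> x"
proof -
  obtain a b d where x: "x = ((a, b), d)"
    by (metis surj_pair)
  have sqrt_ne_0: "complex_of_real (sqrt (real (Suc m))) \<noteq> 0" for m
    by simp
  consider m where "a = Suc m" | m where "b = Suc m" | m where "d = Suc m"
    using assms x by (cases a; cases b; cases d) auto
  then show ?thesis
  proof cases
    case 1
    show ?thesis
      by (rule that[of "((m, b), d)" _ 1, OF _ sqrt_ne_0[of m]])
        (use 1 x assms in \<open>auto simp: mode_op_def on_fst_def annihilate_def\<close>)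
  next
    case 2
    show ?thesis
      by (rule that[of "((a, m), d)" _ 2, OF _ sqrt_ne_0[of m]])
        (use 2 x assms in \<open>auto simp: mode_op_def on_fst_def on_snd_def annihilate_def\<close>)
  next
    case 3
    show ?thesis
      by (rule that[of "((a, b), m)" _ 3, OF _ sqrt_ne_0[of m]])
        (use 3 x assms in \<open>auto simp: mode_op_def on_snd_def annihilate_def\<close>)
  qed
qed

section \<open>Unitary operators and conservation of the photon number\<close>

lemma unitary_op_linear:
  assumes "unitary_op U" and "\<phi> \<in> ell2" and "\<psi> \<in> ell2"
  shows "U (\<lambda>x. a * \<phi> x + b * \<psi> x) = (\<lambda>x. a * U \<phi> x + b * U \<psi> x)"
  using assms unfolding unitary_op_def by meson

lemma unitary_op_braket:
  "unitary_op U \<Longrightarrow> \<phi> \<in> ell2 \<Longrightarrow> \<psi> \<in> ell2 \<Longrightarrow> braket (U \<phi>) (U \<psi>) = braket \<phi> \<psi>"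
  by (simp add: unitary_op_def)

text \<open>Surjectivity gives \<phi> = \<open>U \<omega>\<close>, and preservation of inner
  products identifies each amplitude \<open>braket (U (ket x)) (U \<omega>)\<close> of the adjoint
  with \<open>\<omega> x\<close>.\<close>

lemma unitary_adj_op:
  assumes "unitary_op U" and "\<phi> \<in> ell2"
  shows "U (adj_op U \<phi>) = \<phi>"
proof -
  have "\<phi> \<in> U ` ell2"
    using assms by (simp add: unitary_op_def)
  then obtain \<omega> where \<omega>: "\<omega> \<in> ell2" "\<phi> = U \<omega>"
    by blast
  have "adj_op U \<phi> x = \<omega> x" for x
    using assms \<omega> by (simp add: adj_op_def unitary_op_braket ket_ell2 braket_ket)
  then have "adj_op U \<phi> = \<omega>"
    by blast
  then show ?thesis
    using \<omega> by simp
qed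

text \<open>Applying \<open>U\<close> to the defining relation removes the adjoint; the
  \<open>ell2\<close> clause of \<open>LOP\<close> places \<open>ann i (U \<psi>)\<close> where
  \<open>unitary_adj_op\<close> applies.\<close>

lemma LOP_ann:
  assumes "LOP M U" and "finite {x. \<psi> x \<noteq> 0}"
  shows "ann i (U \<psi>) = U (\<lambda>x. \<Sum>j\<in>UNIV. M $ i $ j * ann j \<psi> x)"
  using assms unitary_adj_op[of U "ann i (U \<psi>)"] by (simp add: LOP_def)

lemma LOP_fixed_photons:
  assumes "LOP M U"
  shows "fixed_photons N \<psi> \<Longrightarrow> fixed_photons N (U \<psi>)"
proof (induction N arbitrary: \<psi>)
  case 0
  \<comment> \<open>Linearity in \<open>unitary_op\<close> concerns combinations of two vectors,
    hence the zero summand.\<close>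
  have eq: "\<psi> = (\<lambda>x. \<psi> ((0, 0), 0) * vacuum x + 0 * vacuum x)"
    using 0 by (auto simp: fixed_photons_def ket_def fun_eq_iff)
  have lin: "U (\<lambda>x. a * vacuum x + b * vacuum x) = (\<lambda>x. a * U vacuum x + b * U vacuum x)" for a b
    using assms by (intro unitary_op_linear ket_ell2) (simp add: LOP_def)
  have "U \<psi> = (\<lambda>x. \<psi> ((0, 0), 0) * U vacuum x + 0 * U vacuum x)"
    unfolding lin[symmetric] by (rule arg_cong[OF eq])
  then show ?case
    using assms by (auto simp: LOP_def fixed_photons_def ket_def)
next
  case (Suc N)
  note fin = fixed_photons_finite[OF Suc.prems]
  show ?case
    unfolding fixed_photons_def
  proof (intro allI impI)
    fix x assume x: "photons x \<noteq> Suc N"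
    show "U \<psi> x = 0"
    proof (cases "photons x")
      case 0
      then have vac: "x = ((0, 0), 0)"
        by (cases x rule: photons.cases) simp
      have "U \<psi> x = braket (U vacuum) (U \<psi>)"
        using assms by (simp add: LOP_def vac braket_ket)
      also have "\<dots> = braket vacuum \<psi>"
        using assms finite_support_ell2[OF fin] by (intro unitary_op_braket ket_ell2) (simp_all add: LOP_def)
      also have "\<dots> = 0"
        using Suc.prems by (simp add: braket_ket fixed_photons_def)
      finally show ?thesis .
    next
      case (Suc n)
      then obtain i y c where y: "photons y = n" "c \<noteq> 0" "ann i (U \<psi>) y = c * U \<psi> x"
        by (rule ann_detects) blast
      \<comment> \<open>The induction hypothesis is needed for this combination of the
        \<open>ann j \<psi>\<close> and not for \<psi> itself, which is why the induction
        generalizes over \<psi>.\<close>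
      have "fixed_photons N (\<lambda>x. \<Sum>j\<in>UNIV. M $ i $ j * ann j \<psi> x)"
        using fixed_photons_ann[OF Suc.prems] by (simp add: fixed_photons_def)
      then have "fixed_photons N (ann i (U \<psi>))"
        unfolding LOP_ann[OF assms fin] by (rule Suc.IH)
      then have "ann i (U \<psi>) y = 0"
        using x y Suc by (simp add: fixed_photons_def del: split_paired_All)
      then show ?thesis
        using y by simp
    qed
  qed
qed

section \<open>On/off detection and the fidelity\<close>

lemma Pi1_apply: "Pi1 \<eta> f n = of_real (1 - (1 - \<eta>) ^ n) * f n"
proof -
  \<comment> \<open>\<open>Pi0\<close> is diagonal in the number basis: at amplitude
    \<open>n\<close> only the projector with \<open>k = n\<close> contributes.\<close>
  have "Pi0 \<eta> f n = (\<Sum>\<^sub>\<infinity>k\<in>{n}. of_real ((1 - \<eta>) ^ k) * outer (ket k) (ket k) f n)"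
    unfolding Pi0_def by (rule infsum_cong_neutral) (auto simp: outer_def ket_def)
  then show ?thesis
    by (simp add: Pi1_def outer_def braket_ket algebra_simps) (simp add: ket_def)
qed

lemma on_snd_Pi1_apply: "on_snd (Pi1 \<eta>) \<psi> (x, k) = of_real (1 - (1 - \<eta>) ^ k) * \<psi> (x, k)"
  by (simp add: on_snd_def Pi1_apply)

lemma braket_self_ne_0:
  assumes "finite {x. \<phi> x \<noteq> 0}" and "\<phi> \<noteq> (\<lambda>x. 0)"
  shows "braket \<phi> \<phi> \<noteq> 0"
proof -
  let ?S = "{x. \<phi> x \<noteq> 0}"
  have "braket \<phi> \<phi> = (\<Sum>x\<in>?S. cnj (\<phi> x) * \<phi> x)"
    by (rule braket_eq_sum) (use assms in auto)
  also have "\<dots> = of_real (\<Sum>x\<in>?S. (cmod (\<phi> x))\<^sup>2)"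
    by (simp add: complex_norm_square mult.commute del: of_real_power)
  finally have eq: "braket \<phi> \<phi> = of_real (\<Sum>x\<in>?S. (cmod (\<phi> x))\<^sup>2)" .
  have "(\<Sum>x\<in>?S. (cmod (\<phi> x))\<^sup>2) > 0"
    by (rule sum_pos) (use assms in auto)
  then show ?thesis
    unfolding eq by (simp only: of_real_eq_0_iff)
qed

theorem mainTheorem6:
  fixes M :: "complex^3^3" and U :: "occ3 oper" and \<psi>0 :: "(nat \<times> nat) cvec"
    and \<psi> :: "occ3 cvec" and \<phi> :: "nat \<Rightarrow> (nat \<times> nat) cvec" and \<eta> :: real
    and A :: "nat \<Rightarrow> real" and \<P>1 P1 F :: complex and \<rho>1 :: "(nat \<times> nat) oper"
  assumes "two_photon \<psi>0" and "braket \<psi>0 \<psi>0 = 1"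
    and "unitary_matrix M" and "LOP M U"
    and "\<psi> = U (tensor \<psi>0 (ket 1))"
    and "\<And>k. \<phi> k = bra_snd (ket k) \<psi>"
    and "\<phi> 1 \<noteq> (\<lambda>x. 0)"
    and "\<P>1 = braket (\<phi> 1) (\<phi> 1)"
    and "0 < \<eta>" and "\<eta> \<le> 1"
    and "P1 = braket \<psi> (on_snd (Pi1 \<eta>) \<psi>)"
    and "\<rho>1 = (\<lambda>\<xi> x. 1 / P1 * partial_trace_snd (outer \<psi> \<psi> \<circ> on_snd (Pi1 \<eta>)) \<xi> x)"
    and "\<And>k. A k = 1 - (1 - \<eta>) ^ k"
    and "F = braket (\<phi> 1) (\<rho>1 (\<phi> 1)) / braket (\<phi> 1) (\<phi> 1)"
  shows "\<psi> = (\<lambda>x. \<Sum>k=0..3. tensor (\<phi> k) (ket k) x) \<and>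
    F = of_real (A 1) * braket (\<phi> 1) (\<phi> 1) /
          (\<Sum>k=1..3. of_real (A k) * braket (\<phi> k) (\<phi> k)) \<and>
    F = of_real \<eta> * (\<P>1 / P1)"
proof -
  \<comment> \<open>Three photons in total leave at most three in each of modes 1 and 2, so this box
    contains the support of every \<open>\<phi> k\<close>.\<close>
  let ?B = "{..3} \<times> {..3} :: (nat \<times> nat) set"
  have "fixed_photons 3 (tensor \<psi>0 (ket 1))"
    using assms(1) by (auto simp: fixed_photons_def tensor_def two_photon_def ket_def)
  then have ph: "fixed_photons 3 \<psi>"
    unfolding assms(5) by (rule LOP_fixed_photons[OF assms(4)])
  have \<phi>: "\<phi> k x = \<psi> (x, k)" for k x
    by (simp add: assms(6) bra_snd_def braket_ket)
  have \<phi>_nz: "fst x + snd x + k = 3" if "\<phi> k x \<noteq> 0" for k x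
    using that ph by (cases x) (auto simp: \<phi> fixed_photons_def)
  have \<phi>_0: "\<phi> k x = 0" if "k \<notin> {0..3}" for k x
    using \<phi>_nz[of k x] that by auto
  have braket_\<phi>: "braket (\<phi> k) \<xi> = (\<Sum>x\<in>?B. cnj (\<phi> k x) * \<xi> x)" for k \<xi>
    by (rule braket_eq_sum) (use \<phi>_nz in fastforce)+
  have orth: "braket (\<phi> 1) (\<phi> k) = 0" if "k \<noteq> 1" for k
    unfolding braket_\<phi>
  proof (rule sum.neutral, intro ballI)
    fix x
    show "cnj (\<phi> 1 x) * \<phi> k x = 0"
      using \<phi>_nz[of 1 x] \<phi>_nz[of k x] that by fastforce
  qed
  have ne: "braket (\<phi> 1) (\<phi> 1) \<noteq> 0"
  proof (rule braket_self_ne_0[OF _ assms(7)])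
    show "finite {x. \<phi> 1 x \<noteq> 0}"
      by (rule finite_subset[of _ ?B]) (use \<phi>_nz in fastforce)+
  qed
  \<comment> \<open>The inner product is split along the occupation of mode 3. Since \<psi> has
    finite support, \<omega> may be arbitrary, as the operator identity \<open>trace\<close>
    requires.\<close>
  have braket_\<psi>: "braket \<psi> \<omega> = (\<Sum>k=0..3. braket (\<phi> k) (\<lambda>x. \<omega> (x, k)))" for \<omega>
  proof -
    have "braket \<psi> \<omega> = (\<Sum>z\<in>?B \<times> {0..3::nat}. cnj (\<psi> z) * \<omega> z)"
    proof (rule braket_eq_sum)
      fix z assume z: "z \<notin> ?B \<times> {0..3::nat}"
      have "\<psi> z = 0"
      proof (rule ccontr)
        assume "\<psi> z \<noteq> 0"
        then have "fst (fst z) + snd (fst z) + snd z = 3"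
          using \<phi>_nz[of "snd z" "fst z"] by (simp add: \<phi>)
        then show False
          using z by (auto simp: mem_Times_iff)
      qed
      then show "\<psi> z = 0 \<or> \<omega> z = 0" ..
    qed simp
    also have "\<dots> = (\<Sum>x\<in>?B. \<Sum>k=0..3. cnj (\<psi> (x, k)) * \<omega> (x, k))"
      unfolding sum.cartesian_product by (simp add: case_prod_unfold)
    also have "\<dots> = (\<Sum>k=0..3. \<Sum>x\<in>?B. cnj (\<psi> (x, k)) * \<omega> (x, k))"
      by (rule sum.swap)
    finally show ?thesis
      by (simp only: braket_\<phi> \<phi>)
  qed
  have scale: "braket (\<phi> k) (\<lambda>x. c * \<xi> x) = c * braket (\<phi> k) \<xi>" for k c \<xi>
    by (simp add: braket_\<phi> sum_distrib_left algebra_simps)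
  have decomp: "\<psi> = (\<lambda>x. \<Sum>k=0..3. tensor (\<phi> k) (ket k) x)"
  proof
    fix z :: occ3
    obtain x l where z: "z = (x, l)"
      by fastforce
    have "(\<Sum>k=0..3. tensor (\<phi> k) (ket k) z) = (\<Sum>k=0..3. if k = l then \<phi> l x else 0)"
      by (rule sum.cong) (auto simp: z tensor_def ket_def)
    also have "\<dots> = \<psi> z"
      using \<phi>_0[of l x] by (auto simp: z \<phi>)
    finally show "\<psi> z = (\<Sum>k=0..3. tensor (\<phi> k) (ket k) z)" ..
  qed
  have P1: "P1 = (\<Sum>k=1..3. of_real (A k) * braket (\<phi> k) (\<phi> k))"
  proof -
    have "P1 = (\<Sum>k=0..3. of_real (A k) * braket (\<phi> k) (\<phi> k))"
      unfolding assms(11) braket_\<psi>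
      by (simp only: on_snd_Pi1_apply scale assms(13) flip: \<phi>)
    \<comment> \<open>The term \<open>k = 0\<close> drops out because \<open>A 0 = 0\<close>; this
      includes \<eta> = 1, where \<open>0 ^ 0 = 1\<close>.\<close>
    then show ?thesis
      by (simp add: sum.atLeast_Suc_atMost[of 0] assms(13))
  qed
  \<comment> \<open>Up to the factor \<open>1 / P1\<close>, the conditional state is the mixture of
    the |\<open>\<phi> k\<close>><\<open>\<phi> k\<close>| with weights \<open>A k\<close>: a
    detector diagonal in the number basis leaves no cross terms between different
    \<open>k\<close>.\<close>
  have trace: "partial_trace_snd (outer \<psi> \<psi> \<circ> on_snd (Pi1 \<eta>)) \<xi> x =
      (\<Sum>k=0..3. of_real (A k) * braket (\<phi> k) \<xi> * \<phi> k x)" for \<xi> x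
  proof -
    \<comment> \<open>The factor \<open>\<phi> k x\<close> is kept on both sides so that the
      identity also holds for \<open>k > 3\<close>, where it vanishes.\<close>
    have click: "braket \<psi> (on_snd (Pi1 \<eta>) (tensor \<xi> (ket k))) * \<phi> k x =
        of_real (A k) * braket (\<phi> k) \<xi> * \<phi> k x" for k
    proof (cases "k \<in> {0..3}")
      case True
      have tensor: "tensor \<xi> (ket k) (y, l) = ket k l * \<xi> y" for y l
        by (simp add: tensor_def)
      have "braket \<psi> (on_snd (Pi1 \<eta>) (tensor \<xi> (ket k))) =
          (\<Sum>l=0..3. of_real (A l) * ket k l * braket (\<phi> l) \<xi>)"
        by (simp only: braket_\<psi> on_snd_Pi1_apply tensor scale mult.assoc flip: assms(13))
      also have "\<dots> = (\<Sum>l=0..3. if l = k then of_real (A k) * braket (\<phi> k) \<xi> else 0)"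
        by (rule sum.cong) (auto simp: ket_def)
      also have "\<dots> = of_real (A k) * braket (\<phi> k) \<xi>"
        using True by simp
      finally show ?thesis
        by simp
    qed (simp add: \<phi>_0)
    have "partial_trace_snd (outer \<psi> \<psi> \<circ> on_snd (Pi1 \<eta>)) \<xi> x =
        (\<Sum>\<^sub>\<infinity>k. of_real (A k) * braket (\<phi> k) \<xi> * \<phi> k x)"
      unfolding click[symmetric]
      by (simp add: partial_trace_snd_def bra_snd_def braket_ket outer_def \<phi>)
    also have "\<dots> = (\<Sum>\<^sub>\<infinity>k\<in>{0..3}. of_real (A k) * braket (\<phi> k) \<xi> * \<phi> k x)"
      by (rule infsum_cong_neutral) (auto simp: \<phi>_0)
    finally show ?thesis
      by simp
  qed
  have "braket (\<phi> 1) (\<rho>1 (\<phi> 1)) =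
      1 / P1 * (\<Sum>k=0..3. of_real (A k) * braket (\<phi> k) (\<phi> 1) * braket (\<phi> 1) (\<phi> k))"
  proof -
    have "braket (\<phi> 1) (\<rho>1 (\<phi> 1)) =
        1 / P1 * braket (\<phi> 1) (\<lambda>x. \<Sum>k=0..3. of_real (A k) * braket (\<phi> k) (\<phi> 1) * \<phi> k x)"
      unfolding assms(12) trace scale ..
    also have "braket (\<phi> 1) (\<lambda>x. \<Sum>k=0..3. of_real (A k) * braket (\<phi> k) (\<phi> 1) * \<phi> k x) =
        (\<Sum>k=0..3. braket (\<phi> 1) (\<lambda>x. of_real (A k) * braket (\<phi> k) (\<phi> 1) * \<phi> k x))"
      unfolding braket_\<phi>[of 1] sum_distrib_left by (rule sum.swap)
    finally show ?thesis
      by (simp only: scale)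
  qed
  also have "(\<Sum>k=0..3. of_real (A k) * braket (\<phi> k) (\<phi> 1) * braket (\<phi> 1) (\<phi> k)) =
      (\<Sum>k=0..3::nat. if k = 1 then of_real (A 1) * braket (\<phi> 1) (\<phi> 1) * braket (\<phi> 1) (\<phi> 1) else 0)"
    by (rule sum.cong) (use orth in auto)
  also have "\<dots> = of_real (A 1) * braket (\<phi> 1) (\<phi> 1) * braket (\<phi> 1) (\<phi> 1)"
    by simp
  \<comment> \<open>One of the two factors \<open>braket (\<phi> 1) (\<phi> 1)\<close> cancels
    against the normalization of the target state.\<close>
  finally have F: "F = of_real (A 1) * braket (\<phi> 1) (\<phi> 1) / P1"
    using ne by (simp add: assms(14))
  have "A 1 = \<eta>"
    by (simp add: assms(13))
  with F decomp show ?thesis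
    unfolding P1[symmetric] by (simp add: assms(8))
qed

end
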